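(* Let $\Gamma$ be any finitely generated infinite group such that its $FC$-centre $K(\Gamma)$ is finite, and let $\overline{\Gamma}=\Gamma/K(\Gamma)$. Then the natural homomorphism $\theta_{\overline{\Gamma}}:\mathrm{Aut}(\overline{\Gamma})\to QI(\overline{\Gamma})$, sending an automorphism to its class as a quasi-isometry, is a monomorphism.
   Context: The $FC$-centre of a group $\Gamma$ is the (normal) subgroup $K(\Gamma)=\{\gamma\in\Gamma : [\Gamma:C(\gamma)]<\infty\}$, where $C(\gamma)$ is the centralizer of $\gamma$ in $\Gamma$. A map $f:X\to X'$ (not assumed continuous) between metric spaces $(X,d)$, $(X',d')$ is a quasi-isometry if there are constants $\lambda\ge 1$, $\epsilon\ge 0$, $C\ge 0$ such that $\lambda^{-1}d(x,y)-\epsilon\le d'(f(x),f(y))\le \lambda d(x,y)+\epsilon$ for all $x,y\in X$ and every point of $X'$ is within distance $C$ of the image of $f$. Two maps $f,g:X\to X'$ are quasi-isometrically equivalent if there is a constant $c$ with $d'(f(x),g(x))\le c$ for all $x\in X$. $QI(X)$ is the group, under composition, of equivalence classes $[f]$ of quasi-isometries $f:X\to X$. For a finitely generated group $G$, $QI(G)$ is defined using the word metric $d(g,g')=$ length of $g^{-1}g'$ with respect to a fixed finite generating set (the result does not depend on this choice). Every automorphism $\phi$ of $G$ is a quasi-isometry, and $\theta_G(\phi)=[\phi]$. *)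

theory Defs
  imports "HOL-Algebra.Algebra" "HOL-Analysis.Abstract_Metric_Spaces"
begin

section \<open>The FC-centre\<close>

definition centralizer :: "('a, 'b) monoid_scheme \<Rightarrow> 'a \<Rightarrow> 'a set"
  where "centralizer G g = {h \<in> carrier G. h \<otimes>\<^bsub>G\<^esub> g = g \<otimes>\<^bsub>G\<^esub> h}"

text \<open>The index of a subgroup is finite iff it has finitely many cosets; \<^const>\<open>card\<close> is
  avoided here because it is 0 on infinite sets.\<close>
definition FC_centre :: "('a, 'b) monoid_scheme \<Rightarrow> 'a set"
  where "FC_centre G = {g \<in> carrier G. finite (rcosets\<^bsub>G\<^esub> (centralizer G g))}"


section \<open>Finite generating sets and the word metric\<close>

definition finite_generating_set :: "('a, 'b) monoid_scheme \<Rightarrow> 'a set \<Rightarrow> bool"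
  where "finite_generating_set G S \<longleftrightarrow>
    finite S \<and> S \<subseteq> carrier G \<and> generate G S = carrier G"

definition finitely_generated_group :: "('a, 'b) monoid_scheme \<Rightarrow> bool"
  where "finitely_generated_group G \<longleftrightarrow> (\<exists>S. finite_generating_set G S)"

definition word_value :: "('a, 'b) monoid_scheme \<Rightarrow> 'a list \<Rightarrow> 'a"
  where "word_value G ws = foldr (monoid.mult G) ws \<one>\<^bsub>G\<^esub>"

definition word_length :: "('a, 'b) monoid_scheme \<Rightarrow> 'a set \<Rightarrow> 'a \<Rightarrow> nat"
  where "word_length G S g =
    (LEAST n. \<exists>ws. length ws = n \<and> set ws \<subseteq> S \<union> m_inv G ` S \<and> word_value G ws = g)"

text \<open>Off the carrier the distance is set to 0, as the locale \<^locale>\<open>Metric_space\<close> requires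
  symmetry and nonnegativity everywhere.\<close>
definition word_dist :: "('a, 'b) monoid_scheme \<Rightarrow> 'a set \<Rightarrow> 'a \<Rightarrow> 'a \<Rightarrow> real"
  where "word_dist G S g h =
    (if g \<in> carrier G \<and> h \<in> carrier G then real (word_length G S (m_inv G g \<otimes>\<^bsub>G\<^esub> h)) else 0)"


section \<open>Quasi-isometries\<close>

definition quasi_isometry ::
  "'a set \<Rightarrow> ('a \<Rightarrow> 'a \<Rightarrow> real) \<Rightarrow> 'b set \<Rightarrow> ('b \<Rightarrow> 'b \<Rightarrow> real) \<Rightarrow> ('a \<Rightarrow> 'b) \<Rightarrow> bool"
  where "quasi_isometry M d N d' f \<longleftrightarrow>
    f \<in> M \<rightarrow> N \<and>
    (\<exists>L e C. L \<ge> 1 \<and> e \<ge> 0 \<and> C \<ge> 0 \<and>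
      (\<forall>x\<in>M. \<forall>y\<in>M. inverse L * d x y - e \<le> d' (f x) (f y) \<and> d' (f x) (f y) \<le> L * d x y + e) \<and>
      (\<forall>z\<in>N. \<exists>x\<in>M. d' z (f x) \<le> C))"

definition qi_equivalent :: "'a set \<Rightarrow> ('b \<Rightarrow> 'b \<Rightarrow> real) \<Rightarrow> ('a \<Rightarrow> 'b) \<Rightarrow> ('a \<Rightarrow> 'b) \<Rightarrow> bool"
  where "qi_equivalent M d' f g \<longleftrightarrow> (\<exists>c. \<forall>x\<in>M. d' (f x) (g x) \<le> c)"

text \<open>Maps \<open>M \<rightarrow> M\<close> are represented by functions that are extensional on \<open>M\<close>, as in
  \<^const>\<open>Bij\<close> and \<^const>\<open>AutoGroup\<close>.\<close>
definition self_quasi_isometries :: "'a set \<Rightarrow> ('a \<Rightarrow> 'a \<Rightarrow> real) \<Rightarrow> ('a \<Rightarrow> 'a) set"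
  where "self_quasi_isometries M d = extensional M \<inter> {f. quasi_isometry M d M d f}"

definition qi_rel :: "'a set \<Rightarrow> ('a \<Rightarrow> 'a \<Rightarrow> real) \<Rightarrow> (('a \<Rightarrow> 'a) \<times> ('a \<Rightarrow> 'a)) set"
  where "qi_rel M d =
    {(f, g). f \<in> self_quasi_isometries M d \<and> g \<in> self_quasi_isometries M d \<and> qi_equivalent M d f g}"

text \<open>The product of two classes is the union of the classes of all composites of
  representatives; these classes coincide (lemma \<open>QI_mult_class\<close> below).\<close>
definition QI_space :: "'a set \<Rightarrow> ('a \<Rightarrow> 'a \<Rightarrow> real) \<Rightarrow> ('a \<Rightarrow> 'a) set monoid"
  where "QI_space M d =
    \<lparr>carrier = self_quasi_isometries M d // qi_rel M d,
     monoid.mult = \<lambda>A B. \<Union>f\<in>A. \<Union>g\<in>B. qi_rel M d `` {compose M f g},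
     one = qi_rel M d `` {\<lambda>x\<in>M. x}\<rparr>"

definition QI :: "('a, 'b) monoid_scheme \<Rightarrow> 'a set \<Rightarrow> ('a \<Rightarrow> 'a) set monoid"
  where "QI G S = QI_space (carrier G) (word_dist G S)"

definition qi_theta :: "('a, 'b) monoid_scheme \<Rightarrow> 'a set \<Rightarrow> ('a \<Rightarrow> 'a) \<Rightarrow> ('a \<Rightarrow> 'a) set"
  where "qi_theta G S \<phi> = qi_rel (carrier G) (word_dist G S) `` {\<phi>}"


section \<open>Well-definedness\<close>

subsection \<open>The group of quasi-isometry classes of a metric space\<close>

context Metric_space
begin

lemma id_quasi_isometry: "(\<lambda>x\<in>M. x) \<in> self_quasi_isometries M d"
  unfolding self_quasi_isometries_def quasi_isometry_def
  by (force intro: exI[of _ 1] exI[of _ 0])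

lemma self_qi_funcset: "f \<in> self_quasi_isometries M d \<Longrightarrow> f \<in> M \<rightarrow> M"
  by (simp add: self_quasi_isometries_def quasi_isometry_def)

lemma self_qi_extensional: "f \<in> self_quasi_isometries M d \<Longrightarrow> f \<in> extensional M"
  by (simp add: self_quasi_isometries_def)

lemma self_qi_constants:
  assumes "f \<in> self_quasi_isometries M d"
  obtains L e C where "L \<ge> 1" "e \<ge> 0" "C \<ge> 0"
    "\<And>x y. x \<in> M \<Longrightarrow> y \<in> M \<Longrightarrow> d x y \<le> L * d (f x) (f y) + L * e"
    "\<And>x y. x \<in> M \<Longrightarrow> y \<in> M \<Longrightarrow> d (f x) (f y) \<le> L * d x y + e"
    "\<And>z. z \<in> M \<Longrightarrow> \<exists>x\<in>M. d z (f x) \<le> C"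
proof -
  from assms obtain L e C where *: "L \<ge> 1" "e \<ge> 0" "C \<ge> 0"
    "\<And>x y. x \<in> M \<Longrightarrow> y \<in> M \<Longrightarrow> inverse L * d x y - e \<le> d (f x) (f y)"
    "\<And>x y. x \<in> M \<Longrightarrow> y \<in> M \<Longrightarrow> d (f x) (f y) \<le> L * d x y + e"
    "\<And>z. z \<in> M \<Longrightarrow> \<exists>x\<in>M. d z (f x) \<le> C"
    unfolding self_quasi_isometries_def quasi_isometry_def by blast
  have "d x y \<le> L * d (f x) (f y) + L * e" if "x \<in> M" "y \<in> M" for x y
    using *(4)[OF that] *(1) by (simp add: field_simps)
  with * show ?thesis using that by blast
qed

lemma self_qiI:
  assumes "f \<in> M \<rightarrow> M" "f \<in> extensional M" "L \<ge> 1" "e \<ge> 0" "C \<ge> 0"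
    "\<And>x y. x \<in> M \<Longrightarrow> y \<in> M \<Longrightarrow> d x y \<le> L * d (f x) (f y) + L * e"
    "\<And>x y. x \<in> M \<Longrightarrow> y \<in> M \<Longrightarrow> d (f x) (f y) \<le> L * d x y + e"
    "\<And>z. z \<in> M \<Longrightarrow> \<exists>x\<in>M. d z (f x) \<le> C"
  shows "f \<in> self_quasi_isometries M d"
proof -
  have "inverse L * d x y - e \<le> d (f x) (f y)" if "x \<in> M" "y \<in> M" for x y
    using assms(6)[OF that] assms(3) by (simp add: field_simps)
  with assms have "L \<ge> 1 \<and> e \<ge> 0 \<and> C \<ge> 0 \<and>
      (\<forall>x\<in>M. \<forall>y\<in>M. inverse L * d x y - e \<le> d (f x) (f y) \<and> d (f x) (f y) \<le> L * d x y + e) \<and>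
      (\<forall>z\<in>M. \<exists>x\<in>M. d z (f x) \<le> C)" by simp
  then have "quasi_isometry M d M d f"
    unfolding quasi_isometry_def by (intro conjI[OF assms(1)] exI)
  with assms(2) show ?thesis by (simp add: self_quasi_isometries_def)
qed

lemma compose_quasi_isometry:
  assumes f: "f \<in> self_quasi_isometries M d" and g: "g \<in> self_quasi_isometries M d"
  shows "compose M f g \<in> self_quasi_isometries M d"
proof -
  obtain L e C where F: "L \<ge> 1" "e \<ge> 0" "C \<ge> 0"
    "\<And>x y. x \<in> M \<Longrightarrow> y \<in> M \<Longrightarrow> d x y \<le> L * d (f x) (f y) + L * e"
    "\<And>x y. x \<in> M \<Longrightarrow> y \<in> M \<Longrightarrow> d (f x) (f y) \<le> L * d x y + e"
    "\<And>z. z \<in> M \<Longrightarrow> \<exists>x\<in>M. d z (f x) \<le> C"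
    using self_qi_constants[OF f] by blast
  obtain L' e' C' where G: "L' \<ge> 1" "e' \<ge> 0" "C' \<ge> 0"
    "\<And>x y. x \<in> M \<Longrightarrow> y \<in> M \<Longrightarrow> d x y \<le> L' * d (g x) (g y) + L' * e'"
    "\<And>x y. x \<in> M \<Longrightarrow> y \<in> M \<Longrightarrow> d (g x) (g y) \<le> L' * d x y + e'"
    "\<And>z. z \<in> M \<Longrightarrow> \<exists>x\<in>M. d z (g x) \<le> C'"
    using self_qi_constants[OF g] by blast
  have fM: "\<And>x. x \<in> M \<Longrightarrow> f x \<in> M" and gM: "\<And>x. x \<in> M \<Longrightarrow> g x \<in> M"
    using self_qi_funcset f g by auto
  have LL: "1 * 1 \<le> L * L'" using F(1) G(1) by (intro mult_mono) auto
  have eL: "e' \<le> L * e'" using F(1) G(2) mult_right_mono[of 1 L e'] by simp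
  show ?thesis
  proof (rule self_qiI[where L = "L * L'" and e = "L * e' + e" and C = "C + (L * C' + e)"])
    fix x y assume xy: "x \<in> M" "y \<in> M"
    have "d x y \<le> L' * d (g x) (g y) + L' * e'" using G(4) xy .
    also have "\<dots> \<le> L' * (L * d (f (g x)) (f (g y)) + L * e) + L' * (L * e')"
      using F(4)[of "g x" "g y"] gM xy G(1) eL by (intro add_mono mult_left_mono) auto
    also have "\<dots> = L * L' * d (f (g x)) (f (g y)) + L * L' * e + L * L' * e'"
      by (simp add: algebra_simps)
    also have "\<dots> \<le> L * L' * d (f (g x)) (f (g y)) + L * L' * e + L * L' * (L * e')"
      using eL F(1) G(1) by (intro add_left_mono mult_left_mono) auto
    finally show "d x y \<le> L * L' * d (compose M f g x) (compose M f g y) + L * L' * (L * e' + e)"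
      using xy by (simp add: compose_eq algebra_simps)
    have "d (f (g x)) (f (g y)) \<le> L * d (g x) (g y) + e" using F(5) gM xy by blast
    also have "\<dots> \<le> L * (L' * d x y + e') + e"
      using G(5)[OF xy] F(1) by (intro add_mono mult_left_mono) auto
    finally show "d (compose M f g x) (compose M f g y) \<le> L * L' * d x y + (L * e' + e)"
      using xy by (simp add: compose_eq algebra_simps)
  next
    fix z assume z: "z \<in> M"
    then obtain y where y: "y \<in> M" "d z (f y) \<le> C" using F(6) by blast
    then obtain x where x: "x \<in> M" "d y (g x) \<le> C'" using G(6) by blast
    have "d z (f (g x)) \<le> d z (f y) + d (f y) (f (g x))"
      using triangle z y x fM gM by blast
    also have "d (f y) (f (g x)) \<le> L * d y (g x) + e" using F(5) y x gM by blast
    also have "L * d y (g x) \<le> L * C'" using F(1) x by (intro mult_left_mono) auto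
    finally have "d z (f (g x)) \<le> C + (L * C' + e)" using y by linarith
    then show "\<exists>x\<in>M. d z (compose M f g x) \<le> C + (L * C' + e)"
      using x by (auto simp: compose_eq)
  qed (use LL F G fM gM in \<open>auto simp: compose_def\<close>)
qed

lemma compose_qi_cong:
  assumes "(f, f') \<in> qi_rel M d" "(g, g') \<in> qi_rel M d"
  shows "(compose M f g, compose M f' g') \<in> qi_rel M d"
proof -
  have f: "f \<in> self_quasi_isometries M d" "f' \<in> self_quasi_isometries M d"
    and g: "g \<in> self_quasi_isometries M d" "g' \<in> self_quasi_isometries M d"
    using assms by (auto simp: qi_rel_def)
  obtain a b where a: "\<And>x. x \<in> M \<Longrightarrow> d (f x) (f' x) \<le> a" and b: "\<And>x. x \<in> M \<Longrightarrow> d (g x) (g' x) \<le> b"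
    using assms by (auto simp: qi_rel_def qi_equivalent_def)
  obtain L e where F: "L \<ge> 1" "\<And>x y. x \<in> M \<Longrightarrow> y \<in> M \<Longrightarrow> d (f x) (f y) \<le> L * d x y + e"
    using self_qi_constants[OF f(1)] by metis
  have "d (f (g x)) (f' (g' x)) \<le> (L * b + e) + a" if x: "x \<in> M" for x
  proof -
    have M: "g x \<in> M" "g' x \<in> M" "f (g x) \<in> M" "f (g' x) \<in> M" "f' (g' x) \<in> M"
      using x self_qi_funcset f g by blast+
    have "d (f (g x)) (f' (g' x)) \<le> d (f (g x)) (f (g' x)) + d (f (g' x)) (f' (g' x))"
      using triangle M by blast
    moreover have "d (f (g x)) (f (g' x)) \<le> L * d (g x) (g' x) + e" using F M by blast
    moreover have "L * d (g x) (g' x) \<le> L * b" using b[OF x] F(1) by simp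
    ultimately show ?thesis using a[OF M(2)] by linarith
  qed
  then have "qi_equivalent M d (compose M f g) (compose M f' g')"
    unfolding qi_equivalent_def by (metis compose_eq)
  then show ?thesis using f g compose_quasi_isometry by (simp add: qi_rel_def)
qed

lemma equiv_qi_rel: "equiv (self_quasi_isometries M d) (qi_rel M d)"
proof (rule equivI)
  show "qi_rel M d \<subseteq> self_quasi_isometries M d \<times> self_quasi_isometries M d"
    by (auto simp: qi_rel_def)
  show "refl_on (self_quasi_isometries M d) (qi_rel M d)"
  proof (rule refl_onI)
    fix f assume f: "f \<in> self_quasi_isometries M d"
    have "d (f x) (f x) \<le> 0" if "x \<in> M" for x
      using self_qi_funcset[OF f] that zero by force
    then show "(f, f) \<in> qi_rel M d" using f by (auto simp: qi_rel_def qi_equivalent_def)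
  qed
  show "sym (qi_rel M d)"
    by (auto simp: sym_def qi_rel_def qi_equivalent_def commute)
  show "trans (qi_rel M d)"
  proof (rule transI)
    fix f g h assume "(f, g) \<in> qi_rel M d" "(g, h) \<in> qi_rel M d"
    then obtain a b where *: "\<And>x. x \<in> M \<Longrightarrow> d (f x) (g x) \<le> a" "\<And>x. x \<in> M \<Longrightarrow> d (g x) (h x) \<le> b"
      and fgh: "f \<in> self_quasi_isometries M d" "g \<in> self_quasi_isometries M d"
        "h \<in> self_quasi_isometries M d"
      by (auto simp: qi_rel_def qi_equivalent_def)
    have "d (f x) (h x) \<le> a + b" if "x \<in> M" for x
      using *[OF that] triangle[of "f x" "g x" "h x"] that fgh[THEN self_qi_funcset]
      by (smt (verit) Pi_iff)
    with fgh show "(f, h) \<in> qi_rel M d" by (auto simp: qi_rel_def qi_equivalent_def)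
  qed
qed

lemma QI_mult_class:
  assumes "f \<in> self_quasi_isometries M d" "g \<in> self_quasi_isometries M d"
  shows "qi_rel M d `` {f} \<otimes>\<^bsub>QI_space M d\<^esub> qi_rel M d `` {g} = qi_rel M d `` {compose M f g}"
proof -
  have "qi_rel M d `` {compose M f' g'} = qi_rel M d `` {compose M f g}"
    if "(f, f') \<in> qi_rel M d" "(g, g') \<in> qi_rel M d" for f' g'
    using equiv_class_eq[OF equiv_qi_rel compose_qi_cong[OF that]] by (rule sym)
  moreover have "(f, f) \<in> qi_rel M d" "(g, g) \<in> qi_rel M d"
    using equiv_class_self[OF equiv_qi_rel] assms by blast+
  ultimately have "(\<Union>f'\<in>qi_rel M d `` {f}. \<Union>g'\<in>qi_rel M d `` {g}. qi_rel M d `` {compose M f' g'})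
      = (\<Union>f'\<in>qi_rel M d `` {f}. \<Union>g'\<in>qi_rel M d `` {g}. qi_rel M d `` {compose M f g})"
    by (intro SUP_cong refl) blast
  also have "\<dots> = qi_rel M d `` {compose M f g}"
    using \<open>(f, f) \<in> qi_rel M d\<close> \<open>(g, g) \<in> qi_rel M d\<close> by blast
  finally show ?thesis by (simp add: QI_space_def)
qed

lemma quasi_inverse:
  assumes f: "f \<in> self_quasi_isometries M d"
  obtains h where "h \<in> self_quasi_isometries M d" "(compose M h f, \<lambda>x\<in>M. x) \<in> qi_rel M d"
proof -
  obtain L e C where F: "L \<ge> 1" "e \<ge> 0" "C \<ge> 0"
    "\<And>x y. x \<in> M \<Longrightarrow> y \<in> M \<Longrightarrow> d x y \<le> L * d (f x) (f y) + L * e"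
    "\<And>x y. x \<in> M \<Longrightarrow> y \<in> M \<Longrightarrow> d (f x) (f y) \<le> L * d x y + e"
    "\<And>z. z \<in> M \<Longrightarrow> \<exists>x\<in>M. d z (f x) \<le> C"
    using self_qi_constants[OF f] by blast
  have fM: "\<And>x. x \<in> M \<Longrightarrow> f x \<in> M" using self_qi_funcset f by auto
  obtain h0 where h0: "\<And>z. z \<in> M \<Longrightarrow> h0 z \<in> M \<and> d z (f (h0 z)) \<le> C"
    using F(6) by metis
  define h where "h = restrict h0 M"
  have h: "h \<in> M \<rightarrow> M" "h \<in> extensional M" "\<And>z. z \<in> M \<Longrightarrow> h z \<in> M"
    "\<And>z. z \<in> M \<Longrightarrow> d z (f (h z)) \<le> C"
    using h0 by (auto simp: h_def)
  have close: "d (h (f x)) x \<le> L * C + L * e" if x: "x \<in> M" for x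
  proof -
    have "d (h (f x)) x \<le> L * d (f (h (f x))) (f x) + L * e"
      using F(4)[OF h(3)[OF fM[OF x]] x] .
    moreover have "L * d (f (h (f x))) (f x) \<le> L * C"
      using h(4)[OF fM[OF x]] F(1) commute[of "f x"] by simp
    ultimately show ?thesis by linarith
  qed
  have hqi: "h \<in> self_quasi_isometries M d"
  proof (rule self_qiI[where L = L and e = "L * (2 * C + e)" and C = "L * C + L * e"])
    fix x y assume xy: "x \<in> M" "y \<in> M"
    have M: "h x \<in> M" "h y \<in> M" "f (h x) \<in> M" "f (h y) \<in> M" using xy h fM by auto
    have tri1: "d x y \<le> d (f (h x)) (f (h y)) + 2 * C"
      using triangle[of x "f (h x)" y] triangle[of "f (h x)" "f (h y)" y]
        h(4)[OF xy(1)] h(4)[OF xy(2)] M xy commute[of y "f (h y)"] by simp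
    have tri2: "d (f (h x)) (f (h y)) \<le> d x y + 2 * C"
      using triangle[of "f (h x)" x "f (h y)"] triangle[of x y "f (h y)"]
        h(4)[OF xy(1)] h(4)[OF xy(2)] M xy commute[of x "f (h x)"] by simp
    have "d (h x) (h y) \<le> L * d (f (h x)) (f (h y)) + L * e" using F(4) M by blast
    also have "L * d (f (h x)) (f (h y)) \<le> L * (d x y + 2 * C)" using tri2 F(1) by simp
    finally show "d (h x) (h y) \<le> L * d x y + L * (2 * C + e)" by (simp add: algebra_simps)
    have pos: "0 \<le> 2 * C + e" using F by simp
    then have "1 * (1 * (2 * C + e)) \<le> L * (L * (2 * C + e))"
      using F(1) by (intro mult_mono) auto
    then show "d x y \<le> L * d (h x) (h y) + L * (L * (2 * C + e))"
      using tri1 F(5)[OF M(1,2)] by simp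
  next
    fix z assume z: "z \<in> M"
    show "\<exists>x\<in>M. d z (h x) \<le> L * C + L * e"
      using close[OF z] fM[OF z] commute by metis
  qed (use h F in auto)
  have "qi_equivalent M d (compose M h f) (\<lambda>x\<in>M. x)"
    unfolding qi_equivalent_def using close by (auto simp: compose_eq)
  then show ?thesis
    using that hqi f compose_quasi_isometry id_quasi_isometry by (simp add: qi_rel_def)
qed

theorem group_QI_space: "group (QI_space M d)"
proof (rule groupI)
  let ?R = "qi_rel M d" and ?Q = "self_quasi_isometries M d"
  have car: "\<And>A. A \<in> carrier (QI_space M d) \<longleftrightarrow> (\<exists>f\<in>?Q. A = ?R `` {f})"
    by (auto simp: QI_space_def quotient_def)
  have one: "\<one>\<^bsub>QI_space M d\<^esub> = ?R `` {\<lambda>x\<in>M. x}" by (simp add: QI_space_def)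
  show "\<one>\<^bsub>QI_space M d\<^esub> \<in> carrier (QI_space M d)"
    using car one id_quasi_isometry by blast
  fix A assume "A \<in> carrier (QI_space M d)"
  then obtain f where f: "f \<in> ?Q" "A = ?R `` {f}" using car by blast
  show "\<one>\<^bsub>QI_space M d\<^esub> \<otimes>\<^bsub>QI_space M d\<^esub> A = A"
    using f QI_mult_class[OF id_quasi_isometry f(1)] self_qi_funcset[OF f(1)]
      self_qi_extensional[OF f(1)] by (simp add: one Id_compose)
  obtain h where h: "h \<in> ?Q" "(compose M h f, \<lambda>x\<in>M. x) \<in> ?R"
    using quasi_inverse[OF f(1)] by blast
  have "?R `` {h} \<otimes>\<^bsub>QI_space M d\<^esub> A = \<one>\<^bsub>QI_space M d\<^esub>"
    using QI_mult_class[OF h(1) f(1)] equiv_class_eq[OF equiv_qi_rel h(2)] f one by simp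
  then show "\<exists>B\<in>carrier (QI_space M d). B \<otimes>\<^bsub>QI_space M d\<^esub> A = \<one>\<^bsub>QI_space M d\<^esub>"
    using car h(1) by blast
  fix B assume "B \<in> carrier (QI_space M d)"
  then obtain g where g: "g \<in> ?Q" "B = ?R `` {g}" using car by blast
  show "A \<otimes>\<^bsub>QI_space M d\<^esub> B \<in> carrier (QI_space M d)"
    using f g QI_mult_class car compose_quasi_isometry by metis
  fix D assume "D \<in> carrier (QI_space M d)"
  then obtain k where k: "k \<in> ?Q" "D = ?R `` {k}" using car by blast
  have "compose M (compose M f g) k = compose M f (compose M g k)"
    using compose_assoc[OF self_qi_funcset[OF k(1)]] by metis
  then show "A \<otimes>\<^bsub>QI_space M d\<^esub> B \<otimes>\<^bsub>QI_space M d\<^esub> D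
      = A \<otimes>\<^bsub>QI_space M d\<^esub> (B \<otimes>\<^bsub>QI_space M d\<^esub> D)"
    using f g k by (simp add: QI_mult_class compose_quasi_isometry)
qed

end


subsection \<open>The word metric\<close>

context group
begin

lemma word_value_append:
  assumes "set us \<subseteq> carrier G" "set vs \<subseteq> carrier G"
  shows "word_value G us \<in> carrier G"
    and "word_value G (us @ vs) = word_value G us \<otimes> word_value G vs"
proof -
  have cl: "word_value G ws \<in> carrier G" if "set ws \<subseteq> carrier G" for ws
    using that by (induction ws) (auto simp: word_value_def)
  then show "word_value G us \<in> carrier G" using assms by blast
  show "word_value G (us @ vs) = word_value G us \<otimes> word_value G vs"
    using assms(1)
  proof (induction us)
    case Nil
    then show ?case using cl[OF assms(2)] by (simp add: word_value_def)
  next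
    case (Cons a us)
    then show ?case using cl[OF assms(2)] cl[of us] by (simp add: word_value_def m_assoc)
  qed
qed

lemma word_value_inverse:
  assumes "set ws \<subseteq> carrier G"
  shows "word_value G (rev (map (m_inv G) ws)) = inv (word_value G ws)"
  using assms
proof (induction ws)
  case Nil
  then show ?case by (simp add: word_value_def)
next
  case (Cons a ws)
  have "word_value G (rev (map (m_inv G) (a # ws)))
      = word_value G (rev (map (m_inv G) ws)) \<otimes> word_value G [inv a]"
    using Cons.prems word_value_append(2)[of "rev (map (m_inv G) ws)" "[inv a]"] by auto
  also have "\<dots> = inv (word_value G ws) \<otimes> inv a"
    using Cons by (simp add: word_value_def)
  also have "\<dots> = inv (a \<otimes> word_value G ws)"
    using Cons.prems word_value_append(1)[of ws "[]"] by (simp add: inv_mult_group)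
  finally show ?case by (simp add: word_value_def)
qed

context
  fixes S assumes S: "finite_generating_set G S"
begin

lemma letters_subset: "S \<union> m_inv G ` S \<subseteq> carrier G"
  using S by (auto simp: finite_generating_set_def)

lemma word_exists:
  assumes "g \<in> carrier G"
  shows "\<exists>ws. set ws \<subseteq> S \<union> m_inv G ` S \<and> word_value G ws = g"
proof -
  have "g \<in> generate G S" using assms S by (simp add: finite_generating_set_def)
  then show ?thesis
  proof induction
    case one
    show ?case by (rule exI[of _ "[]"]) (simp add: word_value_def)
  next
    case (incl h)
    then show ?case using letters_subset by (intro exI[of _ "[h]"]) (auto simp: word_value_def)
  next
    case (inv h)
    then show ?case using letters_subset by (intro exI[of _ "[inv h]"]) (auto simp: word_value_def)
  next
    case (eng h1 h2)
    then obtain us vs where *: "set us \<subseteq> S \<union> m_inv G ` S" "word_value G us = h1"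
      "set vs \<subseteq> S \<union> m_inv G ` S" "word_value G vs = h2" by blast
    then have "word_value G (us @ vs) = h1 \<otimes> h2"
      using letters_subset word_value_append(2) subset_trans by metis
    then show ?case using * by (intro exI[of _ "us @ vs"]) auto
  qed
qed

lemma word_length_attained:
  assumes "g \<in> carrier G"
  obtains ws where "set ws \<subseteq> S \<union> m_inv G ` S" "word_value G ws = g" "length ws = word_length G S g"
proof -
  have "\<exists>n ws. length ws = n \<and> set ws \<subseteq> S \<union> m_inv G ` S \<and> word_value G ws = g"
    using word_exists[OF assms] by blast
  then have "\<exists>ws. length ws = word_length G S g \<and> set ws \<subseteq> S \<union> m_inv G ` S \<and> word_value G ws = g"
    unfolding word_length_def by (rule LeastI_ex)
  then show ?thesis using that by blast
qed

lemma word_length_le: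
  assumes "set ws \<subseteq> S \<union> m_inv G ` S"
  shows "word_length G S (word_value G ws) \<le> length ws"
  unfolding word_length_def by (rule Least_le) (use assms in blast)

lemma word_length_inv_le:
  assumes "g \<in> carrier G"
  shows "word_length G S (inv g) \<le> word_length G S g"
proof -
  obtain ws where ws: "set ws \<subseteq> S \<union> m_inv G ` S" "word_value G ws = g"
    "length ws = word_length G S g"
    using word_length_attained[OF assms] .
  have "S \<subseteq> carrier G" using letters_subset by simp
  then have "m_inv G ` (S \<union> m_inv G ` S) \<subseteq> S \<union> m_inv G ` S" by (auto simp: subset_iff)
  with image_mono[OF ws(1)] have "set (rev (map (m_inv G) ws)) \<subseteq> S \<union> m_inv G ` S"
    unfolding set_rev set_map by (rule order_trans)
  from word_length_le[OF this] show ?thesis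
    using ws word_value_inverse[of ws] letters_subset by auto
qed

theorem Metric_space_word_dist: "Metric_space (carrier G) (word_dist G S)"
proof
  show "0 \<le> word_dist G S x y" for x y by (simp add: word_dist_def)
next
  fix x y
  have le: "word_length G S (inv y \<otimes> x) \<le> word_length G S (inv x \<otimes> y)"
    if "x \<in> carrier G" "y \<in> carrier G" for x y
    using word_length_inv_le[of "inv x \<otimes> y"] that by (simp add: inv_mult_group)
  show "word_dist G S x y = word_dist G S y x"
    using le[of x y] le[of y x] by (auto simp: word_dist_def)
next
  fix x y assume xy: "x \<in> carrier G" "y \<in> carrier G"
  have "word_length G S g = 0 \<longleftrightarrow> g = \<one>" if "g \<in> carrier G" for g
    using word_length_attained[OF that] word_length_le[of "[]"] by (force simp: word_value_def)
  then have "word_dist G S x y = 0 \<longleftrightarrow> inv x \<otimes> y = \<one>" using xy by (simp add: word_dist_def)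
  also have "\<dots> \<longleftrightarrow> x = y" using xy by (metis inv_closed inv_equality inv_inv l_inv)
  finally show "word_dist G S x y = 0 \<longleftrightarrow> x = y" .
next
  fix x y z assume xyz: "x \<in> carrier G" "y \<in> carrier G" "z \<in> carrier G"
  obtain us where us: "set us \<subseteq> S \<union> m_inv G ` S" "word_value G us = inv x \<otimes> y"
    "length us = word_length G S (inv x \<otimes> y)"
    using word_length_attained[of "inv x \<otimes> y"] xyz by auto
  obtain vs where vs: "set vs \<subseteq> S \<union> m_inv G ` S" "word_value G vs = inv y \<otimes> z"
    "length vs = word_length G S (inv y \<otimes> z)"
    using word_length_attained[of "inv y \<otimes> z"] xyz by auto
  have "word_value G (us @ vs) = (inv x \<otimes> y) \<otimes> (inv y \<otimes> z)"
    using us vs letters_subset word_value_append(2) subset_trans by metis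
  also have "\<dots> = inv x \<otimes> z" using xyz m_assoc[of y "inv y" z] by (simp add: m_assoc)
  finally have "word_length G S (inv x \<otimes> z) \<le> length (us @ vs)"
    using word_length_le[of "us @ vs"] us vs by auto
  then show "word_dist G S x z \<le> word_dist G S x y + word_dist G S y z"
    using us vs xyz by (simp add: word_dist_def)
qed

corollary group_QI: "group (QI G S)"
  unfolding QI_def by (rule Metric_space.group_QI_space[OF Metric_space_word_dist])

end


subsection \<open>The quotient by the FC-centre\<close>

text \<open>Orbit-stabilizer: the cosets of the centralizer correspond to the conjugates.\<close>
lemma finite_conjugates_iff:
  assumes g: "g \<in> carrier G"
  shows "finite (rcosets (centralizer G g)) \<longleftrightarrow> finite ((\<lambda>x. inv x \<otimes> g \<otimes> x) ` carrier G)"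
proof -
  have sub: "subgroup (centralizer G g) G"
  proof (rule subgroupI)
    show "inv a \<in> centralizer G g" if "a \<in> centralizer G g" for a
    proof -
      have a: "a \<in> carrier G" "a \<otimes> g = g \<otimes> a" using that by (auto simp: centralizer_def)
      have "g = inv a \<otimes> (a \<otimes> g)" using a(1) g m_assoc[of "inv a" a g] by simp
      then have "g \<otimes> inv a = inv a \<otimes> (g \<otimes> a) \<otimes> inv a" using a(2) by simp
      also have "\<dots> = inv a \<otimes> g" using a g by (simp add: m_assoc)
      finally show ?thesis using a g by (simp add: centralizer_def)
    qed
    show "a \<otimes> b \<in> centralizer G g" if "a \<in> centralizer G g" "b \<in> centralizer G g" for a b
      using that g by (auto simp: centralizer_def m_assoc) (metis m_assoc)
  qed (use g in \<open>auto simp: centralizer_def\<close>)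
  have eq: "centralizer G g #> x = centralizer G g #> y \<longleftrightarrow> inv x \<otimes> g \<otimes> x = inv y \<otimes> g \<otimes> y"
    if xy: "x \<in> carrier G" "y \<in> carrier G" for x y
  proof -
    have "centralizer G g #> x = centralizer G g #> y \<longleftrightarrow> x \<otimes> inv y \<in> centralizer G g"
      using sub xy by (metis coset_join1 coset_join2 coset_mult_inv1 coset_mult_inv2
          inv_closed m_closed subgroup.subset)
    also have "\<dots> \<longleftrightarrow> x \<otimes> inv y \<otimes> g = g \<otimes> x \<otimes> inv y"
      using xy g by (simp add: centralizer_def m_assoc)
    also have "\<dots> \<longleftrightarrow> inv y \<otimes> g = inv x \<otimes> g \<otimes> x \<otimes> inv y"
      using xy g inv_solve_left[of "inv y \<otimes> g" x "g \<otimes> x \<otimes> inv y"] by (auto simp: m_assoc)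
    also have "\<dots> \<longleftrightarrow> inv y \<otimes> g \<otimes> y = inv x \<otimes> g \<otimes> x"
      using xy g inv_solve_right[of "inv y \<otimes> g" "inv x \<otimes> g \<otimes> x" y] by auto
    finally show ?thesis by auto
  qed
  define F where "F = (\<lambda>x. centralizer G g #> x)"
  define c where "c = (\<lambda>x. inv x \<otimes> g \<otimes> x)"
  have "rcosets (centralizer G g) = F ` carrier G" by (auto simp: RCOSETS_def F_def)
  moreover have "finite (F ` carrier G) \<longleftrightarrow> finite (c ` carrier G)"
  proof -
    have "F ` carrier G = (\<lambda>u. F (inv_into (carrier G) c u)) ` (c ` carrier G)"
    proof -
      have "F (inv_into (carrier G) c (c x)) = F x" if "x \<in> carrier G" for x
        using eq[of "inv_into (carrier G) c (c x)" x] that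
          f_inv_into_f[of "c x" c "carrier G"] inv_into_into[of "c x" c "carrier G"]
        by (auto simp: F_def c_def)
      then show ?thesis by (auto simp: image_image)
    qed
    moreover have "c ` carrier G = (\<lambda>u. c (inv_into (carrier G) F u)) ` (F ` carrier G)"
    proof -
      have "c (inv_into (carrier G) F (F x)) = c x" if "x \<in> carrier G" for x
        using eq[of "inv_into (carrier G) F (F x)" x] that
          f_inv_into_f[of "F x" F "carrier G"] inv_into_into[of "F x" F "carrier G"]
        by (auto simp: F_def c_def)
      then show ?thesis by (auto simp: image_image)
    qed
    ultimately show ?thesis by (metis finite_imageI)
  qed
  ultimately show ?thesis by (simp add: c_def)
qed

theorem normal_FC_centre: "FC_centre G \<lhd> G"
proof -
  let ?c = "\<lambda>g x. inv x \<otimes> g \<otimes> x"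
  have FC: "g \<in> FC_centre G \<longleftrightarrow> g \<in> carrier G \<and> finite (?c g ` carrier G)" for g
    using finite_conjugates_iff by (auto simp: FC_centre_def)
  have "subgroup (FC_centre G) G"
  proof (rule subgroupI)
    have "?c \<one> ` carrier G \<subseteq> {\<one>}" by auto
    then have "finite (?c \<one> ` carrier G)" by (rule finite_subset) simp
    then show "FC_centre G \<noteq> {}" using FC by blast
  next
    fix a assume a: "a \<in> FC_centre G"
    have "?c (inv a) x = inv (?c a x)" if "x \<in> carrier G" for x
      using a that by (simp add: FC inv_mult_group m_assoc)
    then have "?c (inv a) ` carrier G = m_inv G ` ?c a ` carrier G"
      unfolding image_image by (intro image_cong refl) blast
    moreover have "finite (m_inv G ` ?c a ` carrier G)" using a FC by blast
    ultimately show "inv a \<in> FC_centre G" using a by (simp add: FC)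
  next
    fix a b assume ab: "a \<in> FC_centre G" "b \<in> FC_centre G"
    have "?c (a \<otimes> b) x = ?c a x \<otimes> ?c b x" if "x \<in> carrier G" for x
    proof -
      have "x \<otimes> (inv x \<otimes> (b \<otimes> x)) = b \<otimes> x"
        using that ab FC m_assoc[of x "inv x" "b \<otimes> x"] by simp
      then show ?thesis using that ab FC by (simp add: m_assoc)
    qed
    then have "?c (a \<otimes> b) ` carrier G
        \<subseteq> (\<lambda>(u, v). u \<otimes> v) ` (?c a ` carrier G \<times> ?c b ` carrier G)"
      by force
    moreover have "finite ((\<lambda>(u, v). u \<otimes> v) ` (?c a ` carrier G \<times> ?c b ` carrier G))"
      using ab FC by blast
    ultimately show "a \<otimes> b \<in> FC_centre G" using ab FC by (meson finite_subset m_closed)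
  qed (use FC in blast)
  moreover have "x \<otimes> h \<otimes> inv x \<in> FC_centre G" if "x \<in> carrier G" "h \<in> FC_centre G" for x h
  proof -
    have "?c (x \<otimes> h \<otimes> inv x) y = ?c h (inv x \<otimes> y)" if "y \<in> carrier G" for y
      using that \<open>x \<in> carrier G\<close> \<open>h \<in> FC_centre G\<close> FC by (simp add: m_assoc inv_mult_group)
    then have "?c (x \<otimes> h \<otimes> inv x) ` carrier G \<subseteq> ?c h ` carrier G"
      using \<open>x \<in> carrier G\<close> by auto
    then show ?thesis using that FC by (meson finite_subset inv_closed m_closed)
  qed
  ultimately show ?thesis using normal_inv_iff by blast
qed

lemma finitely_generated_Mod:
  assumes "finitely_generated_group G" "N \<lhd> G"
  shows "finitely_generated_group (G Mod N)"
proof -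
  interpret N: normal N G by fact
  interpret h: group_hom G "G Mod N" "(#>) N"
    using N.r_coset_hom_Mod N.factorgroup_is_group is_group
    by (simp add: group_hom_def group_hom_axioms_def)
  obtain S where S: "finite S" "S \<subseteq> carrier G" "generate G S = carrier G"
    using assms(1) by (auto simp: finitely_generated_group_def finite_generating_set_def)
  have "(#>) N ` carrier G = carrier (G Mod N)" by (auto simp: FactGroup_def RCOSETS_def)
  then have "finite_generating_set (G Mod N) ((#>) N ` S)"
    using S h.generate_img[of S] by (auto simp: finite_generating_set_def)
  then show ?thesis by (auto simp: finitely_generated_group_def)
qed

end

end

theory Submission
  imports Defs
begin

text \<open>
  Write \<open>G\<close> for the quotient of \<open>\<Gamma>\<close> by its \<open>FC\<close>-centre \<open>K\<close>. The proof rests on two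
  observations.

  First, \<open>G\<close> has trivial \<open>FC\<close>-centre: if the coset of \<open>g\<close> has finitely many conjugates in \<open>G\<close>,
  then the conjugates of \<open>g\<close> in \<open>\<Gamma>\<close> lie in finitely many cosets of \<open>K\<close>, and these are finite
  because \<open>K\<close> is (\<open>FC_centre_finite_quotient\<close>).

  Secondly, let \<open>\<phi>\<close> and \<open>\<psi>\<close> be automorphisms of \<open>G\<close> at bounded distance from each other, and
  put \<open>b y = \<phi>(y)\<inverse> \<psi>(y)\<close>. As balls of the word metric are finite, \<open>b\<close> takes only finitely many
  values. Expanding \<open>b\<close> on a product gives
  \<open>b(yx) = \<phi>(x)\<inverse> b(y) \<phi>(x) \<cdot> b(x)\<close>, so for fixed \<open>y\<close> every conjugate of \<open>b y\<close> by an element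
  \<open>\<phi>(x)\<close> is a quotient of two values of \<open>b\<close>. Since \<open>\<phi>\<close> is onto, these are all conjugates of
  \<open>b y\<close>; there are finitely many of them, and \<open>b y\<close> lies in the \<open>FC\<close>-centre
  (\<open>bounded_distance_imp_FC_centre\<close>). As this is trivial, \<open>\<phi> = \<psi>\<close>.

  That classes of automorphisms make sense in the quasi-isometry group, and multiply correctly,
  follows from the fact that a homomorphism of finitely generated groups is Lipschitz
  (\<open>hom_word_length_bound\<close>), applied to an automorphism and its inverse.
\<close>

section \<open>Word length\<close>

context group
begin

lemma word_length_mult_le:
  assumes S: "finite_generating_set G S" and "g \<in> carrier G" "h \<in> carrier G"
  shows "word_length G S (g \<otimes> h) \<le> word_length G S g + word_length G S h"
proof -
  obtain us where us: "set us \<subseteq> S \<union> m_inv G ` S" "word_value G us = g"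
      "length us = word_length G S g"
    using word_length_attained[OF S assms(2)] .
  obtain vs where vs: "set vs \<subseteq> S \<union> m_inv G ` S" "word_value G vs = h"
      "length vs = word_length G S h"
    using word_length_attained[OF S assms(3)] .
  have "word_value G (us @ vs) = g \<otimes> h"
    using us vs word_value_append(2)[OF order_trans order_trans] letters_subset[OF S] by metis
  then show ?thesis using word_length_le[OF S, of "us @ vs"] us vs by simp
qed

lemma finite_word_ball:
  assumes S: "finite_generating_set G S"
  shows "finite {g \<in> carrier G. word_length G S g \<le> n}"
proof (rule finite_subset)
  let ?W = "{ws. set ws \<subseteq> S \<union> m_inv G ` S \<and> length ws \<le> n}"
  show "{g \<in> carrier G. word_length G S g \<le> n} \<subseteq> word_value G ` ?W"
  proof clarify
    fix g assume "g \<in> carrier G" "word_length G S g \<le> n"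
    moreover obtain ws where "set ws \<subseteq> S \<union> m_inv G ` S" "word_value G ws = g"
        "length ws = word_length G S g"
      using word_length_attained[OF S \<open>g \<in> carrier G\<close>] .
    ultimately have "ws \<in> ?W" "g = word_value G ws" by auto
    then show "g \<in> word_value G ` ?W" by (rule rev_image_eqI)
  qed
  have "finite (S \<union> m_inv G ` S)" using S by (simp add: finite_generating_set_def)
  then show "finite (word_value G ` ?W)" by (intro finite_imageI finite_lists_length_le)
qed

end

text \<open>The Lipschitz constant is the largest length of the image of a letter.\<close>
lemma hom_word_length_bound:
  assumes G: "group G" and H: "group H" and h: "h \<in> hom G H"
    and S: "finite_generating_set G S" and T: "finite_generating_set H T"
  obtains L where "\<And>g. g \<in> carrier G \<Longrightarrow> word_length H T (h g) \<le> L * word_length G S g"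
proof -
  interpret G: group G by fact
  interpret H: group H by fact
  interpret h: group_hom G H h by unfold_locales fact
  let ?A = "S \<union> m_inv G ` S"
  have A: "finite ?A" "?A \<subseteq> carrier G"
    using S G.letters_subset[OF S] by (auto simp: finite_generating_set_def)
  obtain L where L: "\<And>a. a \<in> ?A \<Longrightarrow> word_length H T (h a) \<le> L"
    using finite_nat_set_iff_bounded_le[of "(\<lambda>a. word_length H T (h a)) ` ?A"] A(1) by blast
  have words: "word_length H T (h (word_value G ws)) \<le> L * length ws" if "set ws \<subseteq> ?A" for ws
    using that
  proof (induction ws)
    case Nil
    then show ?case using H.word_length_le[OF T, of "[]"] by (simp add: word_value_def)
  next
    case (Cons a ws)
    have car: "a \<in> carrier G" "word_value G ws \<in> carrier G"
      using Cons.prems A(2) G.word_value_append(1)[of ws "[]"] by auto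
    have "h (word_value G (a # ws)) = h a \<otimes>\<^bsub>H\<^esub> h (word_value G ws)"
      using car by (simp add: word_value_def)
    then have "word_length H T (h (word_value G (a # ws)))
        \<le> word_length H T (h a) + word_length H T (h (word_value G ws))"
      using H.word_length_mult_le[OF T] car by simp
    also have "\<dots> \<le> L + L * length ws" using Cons L[of a] by (intro add_mono) auto
    finally show ?case by simp
  qed
  have "word_length H T (h g) \<le> L * word_length G S g" if "g \<in> carrier G" for g
    using G.word_length_attained[OF S that] words by metis
  then show ?thesis using that by blast
qed


section \<open>Automorphisms as quasi-isometries\<close>

context group
begin

lemma hom_word_dist_bound:
  assumes h: "h \<in> hom G G" and S: "finite_generating_set G S"
  obtains L where "L \<ge> 1"
    "\<And>x y. x \<in> carrier G \<Longrightarrow> y \<in> carrier G \<Longrightarrow> word_dist G S (h x) (h y) \<le> L * word_dist G S x y"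
proof -
  interpret h: group_hom G G h by unfold_locales fact
  obtain L where L: "\<And>g. g \<in> carrier G \<Longrightarrow> word_length G S (h g) \<le> L * word_length G S g"
    using hom_word_length_bound[OF is_group is_group h S S] by blast
  \<comment> \<open>Quasi-isometry constants are at least 1, while \<open>L\<close> may be 0.\<close>
  have "word_dist G S (h x) (h y) \<le> real (max 1 L) * word_dist G S x y"
    if xy: "x \<in> carrier G" "y \<in> carrier G" for x y
  proof -
    have eq: "inv (h x) \<otimes> h y = h (inv x \<otimes> y)" using xy by simp
    then have "word_length G S (inv (h x) \<otimes> h y) \<le> L * word_length G S (inv x \<otimes> y)"
      using L[of "inv x \<otimes> y"] xy unfolding eq by (meson inv_closed m_closed)
    also have "\<dots> \<le> max 1 L * word_length G S (inv x \<otimes> y)" by (intro mult_right_mono) auto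
    finally have "real (word_length G S (inv (h x) \<otimes> h y))
        \<le> real (max 1 L * word_length G S (inv x \<otimes> y))"
      by (rule of_nat_mono)
    then show ?thesis using xy by (simp add: word_dist_def)
  qed
  then show ?thesis using that[of "real (max 1 L)"] by simp
qed

text \<open>The upper distance estimate is the Lipschitz bound for \<open>\<phi>\<close>, the lower one that for its
  inverse.\<close>
lemma auto_self_quasi_isometry:
  assumes \<phi>: "\<phi> \<in> auto G" and S: "finite_generating_set G S"
  shows "\<phi> \<in> self_quasi_isometries (carrier G) (word_dist G S)"
proof -
  interpret Metric_space "carrier G" "word_dist G S" by (rule Metric_space_word_dist[OF S])
  have hom: "\<phi> \<in> hom G G" and ext: "\<phi> \<in> extensional (carrier G)"
    and bij: "bij_betw \<phi> (carrier G) (carrier G)"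
    using \<phi> by (auto simp: auto_def Bij_def)
  define \<psi> where "\<psi> = restrict (inv_into (carrier G) \<phi>) (carrier G)"
  have "\<psi> \<in> hom G G" using \<phi> restrict_inv_into_hom by (simp add: auto_def \<psi>_def)
  obtain L where L: "L \<ge> 1" "\<And>x y. x \<in> carrier G \<Longrightarrow> y \<in> carrier G \<Longrightarrow>
      word_dist G S (\<phi> x) (\<phi> y) \<le> L * word_dist G S x y"
    using hom_word_dist_bound[OF hom S] by blast
  obtain L' where L': "L' \<ge> 1" "\<And>x y. x \<in> carrier G \<Longrightarrow> y \<in> carrier G \<Longrightarrow>
      word_dist G S (\<psi> x) (\<psi> y) \<le> L' * word_dist G S x y"
    using hom_word_dist_bound[OF \<open>\<psi> \<in> hom G G\<close> S] by blast
  have cl: "\<phi> x \<in> carrier G" if "x \<in> carrier G" for x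
    using bij that by (rule bij_betw_apply)
  have inv: "\<psi> (\<phi> x) = x" if "x \<in> carrier G" for x
    using bij that cl by (simp add: \<psi>_def bij_betw_inv_into_left)
  show ?thesis
  proof (rule self_qiI[where L = "max L L'" and e = 0 and C = 0])
    fix x y assume xy: "x \<in> carrier G" "y \<in> carrier G"
    have "word_dist G S x y \<le> L' * word_dist G S (\<phi> x) (\<phi> y)"
      using L'(2)[OF cl cl] xy inv by metis
    also have "\<dots> \<le> max L L' * word_dist G S (\<phi> x) (\<phi> y)" by (intro mult_right_mono) auto
    finally show "word_dist G S x y \<le> max L L' * word_dist G S (\<phi> x) (\<phi> y) + max L L' * 0" by simp
    have "word_dist G S (\<phi> x) (\<phi> y) \<le> L * word_dist G S x y" using L(2)[OF xy] .
    also have "\<dots> \<le> max L L' * word_dist G S x y" by (intro mult_right_mono) auto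
    finally show "word_dist G S (\<phi> x) (\<phi> y) \<le> max L L' * word_dist G S x y + 0" by simp
  next
    fix z assume "z \<in> carrier G"
    moreover from this obtain x where "x \<in> carrier G" "z = \<phi> x"
      using bij_betw_imp_surj_on[OF bij] by (metis imageE)
    ultimately show "\<exists>x\<in>carrier G. word_dist G S z (\<phi> x) \<le> 0" by (metis mdist_zero order_refl)
  qed (use cl ext L(1) in simp_all)
qed

lemma qi_theta_hom:
  assumes S: "finite_generating_set G S"
  shows "qi_theta G S \<in> hom (AutoGroup G) (QI G S)"
proof (rule homI)
  interpret Metric_space "carrier G" "word_dist G S" by (rule Metric_space_word_dist[OF S])
  fix \<phi> assume \<phi>: "\<phi> \<in> carrier (AutoGroup G)"
  then have \<phi>': "\<phi> \<in> auto G" by (simp add: AutoGroup_def)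
  show "qi_theta G S \<phi> \<in> carrier (QI G S)"
    using auto_self_quasi_isometry[OF \<phi>' S]
    by (simp add: QI_def QI_space_def qi_theta_def quotientI)
  fix \<psi> assume \<psi>: "\<psi> \<in> carrier (AutoGroup G)"
  then have \<psi>': "\<psi> \<in> auto G" by (simp add: AutoGroup_def)
  have "\<phi> \<otimes>\<^bsub>AutoGroup G\<^esub> \<psi> = compose (carrier G) \<phi> \<psi>"
    using \<phi>' \<psi>' by (simp add: AutoGroup_def BijGroup_def auto_def)
  then show "qi_theta G S (\<phi> \<otimes>\<^bsub>AutoGroup G\<^esub> \<psi>)
      = qi_theta G S \<phi> \<otimes>\<^bsub>QI G S\<^esub> qi_theta G S \<psi>"
    using QI_mult_class auto_self_quasi_isometry[OF _ S] \<phi>' \<psi>'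
    by (simp add: QI_def qi_theta_def)
qed


section \<open>Homomorphisms at bounded distance\<close>

text \<open>The set \<open>B\<close> of values of \<open>b y = \<phi>(y)\<inverse> \<psi>(y)\<close> is finite, and
  \<open>\<phi>(x)\<inverse> b(y) \<phi>(x) = b(yx) b(x)\<inverse>\<close> confines the conjugates of \<open>b y\<close> to \<open>B B\<inverse>\<close>.\<close>
lemma bounded_distance_imp_FC_centre:
  assumes S: "finite_generating_set G S"
    and \<phi>: "\<phi> \<in> epi G G" and \<psi>: "\<psi> \<in> hom G G"
    and equiv: "qi_equivalent (carrier G) (word_dist G S) \<phi> \<psi>"
    and y: "y \<in> carrier G"
  shows "inv (\<phi> y) \<otimes> \<psi> y \<in> FC_centre G"
proof -
  have onto: "\<phi> ` carrier G = carrier G" using \<phi> by (simp add: epi_def)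
  interpret \<phi>: group_hom G G \<phi> using \<phi> by unfold_locales (simp add: epi_def)
  interpret \<psi>: group_hom G G \<psi> by unfold_locales fact
  define b where "b = (\<lambda>x. inv (\<phi> x) \<otimes> \<psi> x)"
  have b_closed: "b x \<in> carrier G" if "x \<in> carrier G" for x using that by (simp add: b_def)
  obtain c where c: "\<And>x. x \<in> carrier G \<Longrightarrow> word_dist G S (\<phi> x) (\<psi> x) \<le> c"
    using equiv by (auto simp: qi_equivalent_def)
  have "word_length G S (b x) \<le> nat \<lfloor>c\<rfloor>" if "x \<in> carrier G" for x
    using c[OF that] that by (simp add: word_dist_def b_def le_nat_floor)
  then have "b ` carrier G \<subseteq> {g \<in> carrier G. word_length G S g \<le> nat \<lfloor>c\<rfloor>}"
    using b_closed by blast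
  then have fin: "finite (b ` carrier G)" using finite_word_ball[OF S] by (rule finite_subset)
  have conj: "inv (\<phi> x) \<otimes> b y \<otimes> \<phi> x = b (y \<otimes> x) \<otimes> inv (b x)" if x: "x \<in> carrier G" for x
  proof -
    have "\<phi> x \<otimes> b x = \<psi> x" using x m_assoc[of "\<phi> x" "inv (\<phi> x)" "\<psi> x"] by (simp add: b_def)
    then have "inv (\<phi> x) \<otimes> b y \<otimes> \<phi> x \<otimes> b x = inv (\<phi> x) \<otimes> b y \<otimes> \<psi> x"
      using x y b_closed by (simp add: m_assoc)
    also have "\<dots> = b (y \<otimes> x)" using x y by (simp add: b_def inv_mult_group m_assoc)
    finally show ?thesis using x y b_closed by (simp add: inv_solve_right)
  qed
  have "(\<lambda>z. inv z \<otimes> b y \<otimes> z) ` carrier G = (\<lambda>x. inv (\<phi> x) \<otimes> b y \<otimes> \<phi> x) ` carrier G"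
    using image_image[of "\<lambda>z. inv z \<otimes> b y \<otimes> z" \<phi> "carrier G"] by (simp only: onto)
  also have "\<dots> \<subseteq> (\<lambda>(u, v). u \<otimes> inv v) ` (b ` carrier G \<times> b ` carrier G)"
    using conj y by force
  finally have "finite ((\<lambda>z. inv z \<otimes> b y \<otimes> z) ` carrier G)"
    by (rule finite_subset) (use fin in blast)
  then have "b y \<in> FC_centre G"
    using finite_conjugates_iff b_closed[OF y] by (simp add: FC_centre_def)
  then show ?thesis by (simp add: b_def)
qed

theorem qi_theta_mon:
  assumes S: "finite_generating_set G S" and FC: "FC_centre G = {\<one>}"
  shows "qi_theta G S \<in> mon (AutoGroup G) (QI G S)"
proof -
  interpret Metric_space "carrier G" "word_dist G S" by (rule Metric_space_word_dist[OF S])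
  have "inj_on (qi_theta G S) (carrier (AutoGroup G))"
  proof (rule inj_onI)
    fix \<phi> \<psi>
    assume "\<phi> \<in> carrier (AutoGroup G)" "\<psi> \<in> carrier (AutoGroup G)"
      and eq: "qi_theta G S \<phi> = qi_theta G S \<psi>"
    then have auto: "\<phi> \<in> auto G" "\<psi> \<in> auto G" by (auto simp: AutoGroup_def)
    then have hom: "\<phi> \<in> epi G G" "\<phi> \<in> hom G G" "\<psi> \<in> hom G G"
      and ext: "\<phi> \<in> extensional (carrier G)" "\<psi> \<in> extensional (carrier G)"
      by (auto simp: auto_def epi_def Bij_def bij_betw_def)
    have "(\<phi>, \<psi>) \<in> qi_rel (carrier G) (word_dist G S)"
      using eq eq_equiv_class[OF _ equiv_qi_rel] auto_self_quasi_isometry[OF auto(2) S]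
      by (simp add: qi_theta_def)
    then have "qi_equivalent (carrier G) (word_dist G S) \<phi> \<psi>" by (simp add: qi_rel_def)
    then have *: "inv (\<phi> y) \<otimes> \<psi> y = \<one>" if "y \<in> carrier G" for y
      using bounded_distance_imp_FC_centre[OF S hom(1,3) _ that] FC by blast
    have "\<phi> y = \<psi> y" if "y \<in> carrier G" for y
      using *[OF that] hom_in_carrier[OF hom(2) that] hom_in_carrier[OF hom(3) that]
      by (metis inv_closed inv_equality inv_inv)
    then show "\<phi> = \<psi>" using ext by (intro extensionalityI) auto
  qed
  then show ?thesis using qi_theta_hom[OF S] by (simp add: mon_def)
qed


section \<open>The FC-centre of a quotient by a finite subgroup\<close>

text \<open>A conjugate of \<open>g\<close> lies in the corresponding conjugate of its coset, which is a finite set.\<close>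
lemma FC_centre_finite_quotient:
  assumes N: "N \<lhd> G" "finite N" and g: "g \<in> carrier G"
    and FC: "N #> g \<in> FC_centre (G Mod N)"
  shows "g \<in> FC_centre G"
proof -
  interpret N: normal N G by fact
  interpret Q: group "G Mod N" by (rule N.factorgroup_is_group)
  interpret p: group_hom G "G Mod N" "(#>) N"
    by unfold_locales (rule N.r_coset_hom_Mod)
  let ?C = "(\<lambda>Y. inv\<^bsub>G Mod N\<^esub> Y \<otimes>\<^bsub>G Mod N\<^esub> (N #> g) \<otimes>\<^bsub>G Mod N\<^esub> Y) ` carrier (G Mod N)"
  have fin: "finite ?C" using Q.finite_conjugates_iff FC by (auto simp: FC_centre_def)
  have coset: "finite Y" if Y: "Y \<in> carrier (G Mod N)" for Y
    using Y N(2) by (auto simp: FactGroup_def RCOSETS_def r_coset_def)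
  have C: "?C \<subseteq> carrier (G Mod N)"
    using p.hom_closed[OF g] by (intro image_subsetI Q.m_closed Q.inv_closed)
  have "inv x \<otimes> g \<otimes> x \<in> \<Union>?C" if x: "x \<in> carrier G" for x
  proof (rule UnionI)
    show "inv x \<otimes> g \<otimes> x \<in> N #> (inv x \<otimes> g \<otimes> x)"
      using x g by (intro rcos_self N.subgroup_axioms) auto
    have "N #> (inv x \<otimes> g \<otimes> x)
        = inv\<^bsub>G Mod N\<^esub> (N #> x) \<otimes>\<^bsub>G Mod N\<^esub> (N #> g) \<otimes>\<^bsub>G Mod N\<^esub> (N #> x)"
      using x g by (simp only: p.hom_mult p.hom_inv inv_closed m_closed)
    then show "N #> (inv x \<otimes> g \<otimes> x) \<in> ?C" using x p.hom_closed by blast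
  qed
  then have "(\<lambda>x. inv x \<otimes> g \<otimes> x) ` carrier G \<subseteq> \<Union>?C" by blast
  moreover have "finite (\<Union>?C)" using fin coset C by blast
  ultimately have "finite ((\<lambda>x. inv x \<otimes> g \<otimes> x) ` carrier G)" by (rule finite_subset)
  then show ?thesis using finite_conjugates_iff[OF g] g by (simp add: FC_centre_def)
qed

corollary FC_centre_Mod_FC_centre:
  assumes "finite (FC_centre G)"
  shows "FC_centre (G Mod FC_centre G) = {\<one>\<^bsub>G Mod FC_centre G\<^esub>}"
proof
  let ?K = "FC_centre G"
  interpret K: normal ?K G by (rule normal_FC_centre)
  interpret Q: group "G Mod ?K" by (rule K.factorgroup_is_group)
  show "{\<one>\<^bsub>G Mod ?K\<^esub>} \<subseteq> FC_centre (G Mod ?K)"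
    using subgroup.one_closed[OF normal_imp_subgroup[OF Q.normal_FC_centre]] by simp
  show "FC_centre (G Mod ?K) \<subseteq> {\<one>\<^bsub>G Mod ?K\<^esub>}"
  proof
    fix Y assume Y: "Y \<in> FC_centre (G Mod ?K)"
    then have "Y \<in> carrier (G Mod ?K)" unfolding FC_centre_def[of "G Mod ?K"] by blast
    then obtain g where g: "g \<in> carrier G" "Y = ?K #> g"
      by (auto simp: FactGroup_def RCOSETS_def)
    then have "g \<in> ?K" using FC_centre_finite_quotient[OF K.normal_axioms assms] Y by blast
    then show "Y \<in> {\<one>\<^bsub>G Mod ?K\<^esub>}"
      using g K.rcos_const by (simp add: FactGroup_def)
  qed
qed

end

theorem theorem1p2:
  fixes \<Gamma> :: "('a, 'b) monoid_scheme" and S :: "'a set set"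
  assumes "group \<Gamma>"
    and "finitely_generated_group \<Gamma>"
    and "infinite (carrier \<Gamma>)"
    and "finite (FC_centre \<Gamma>)"
    and "finite_generating_set (\<Gamma> Mod FC_centre \<Gamma>) S"
  shows "qi_theta (\<Gamma> Mod FC_centre \<Gamma>) S
    \<in> mon (AutoGroup (\<Gamma> Mod FC_centre \<Gamma>)) (QI (\<Gamma> Mod FC_centre \<Gamma>) S)"
proof -
  interpret group \<Gamma> by fact
  interpret Q: group "\<Gamma> Mod FC_centre \<Gamma>"
    by (rule normal.factorgroup_is_group[OF normal_FC_centre])
  show ?thesis
    using assms(5) FC_centre_Mod_FC_centre[OF assms(4)] by (rule Q.qi_theta_mon)
qed

end
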